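(* Suppose $(S_t,V_t)_{t\ge 0}$ is a real-valued sub-$\psi$ process for some CGF-like function $\psi:[0,\lambda_{\max})\to[0,\infty)$ satisfying $\lim_{\lambda\uparrow\lambda_{\max}}\psi'(\lambda)=\infty$. Let $\alpha>1$, $\rho>0$ and $\delta\in(0,1)$ be constants, and let $h:[0,\infty)\to[0,\infty)$ be an increasing function such that $\sum_{k=0}^\infty h(k)^{-1}\le 1$. Define $\ell_\rho:[0,\infty)\to[0,\infty)$ by $$\ell_\rho(v)=\log\left(h\left(\log_\alpha\left(\frac{v\lor\rho}{\rho}\right)\right)\right)+\log\left(\frac1\delta\right).$$ Then $$\mathbb{P}\left(\exists t\ge 0: S_t\ge (V_t\lor\rho)\cdot(\psi^* )^{-1}\left(\frac{\alpha}{V_t\lor\rho}\,\ell_\rho(V_t)\right)\right)\le\delta.$$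
   Context: Time $t$ ranges over $\{0,1,2,\dots\}$; $a\lor b=\max\{a,b\}$. CGF-like: a twice continuously differentiable function $\psi:[0,\lambda_{\max})\to[0,\infty)$ is CGF-like if it is strictly convex, $\psi(0)=\psi'(0)=0$ and $\psi''(0)>0$. Convex conjugate: $\psi^*(u)=\sup_{\lambda\in[0,\lambda_{\max})}(u\lambda-\psi(\lambda))$ for $u\in[0,\infty)$ (under $\lim_{\lambda\uparrow\lambda_{\max}}\psi'(\lambda)=\infty$), and $(\psi^* )^{-1}$ is its inverse function. Sub-$\psi$ (scalar): let $(S_t)_{t\ge0}$ and $(V_t)_{t\ge0}$ be respectively $\mathbb{R}$-valued and $[0,\infty)$-valued processes adapted to some filtration $(\mathcal{F}_t)_{t\ge0}$. $(S_t,V_t)_{t\ge0}$ is sub-$\psi$ (equivalently, $(S_t)$ is sub-$\psi$ with variance proxy $(V_t)$) if for every $\lambda\in[0,\lambda_{\max})$ the process $\exp\{\lambda S_t-\psi(\lambda)V_t\}$ is (almost surely) upper bounded by some non-negative supermartingale $(L_t^\lambda)_{t\ge0}$ with respect to $(\mathcal{F}_t)_{t\ge0}$, that is, $\exp\{\lambda S_t-\psi(\lambda)V_t\}\le L_t^\lambda$ for all $t\ge0$.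
   Formalization: The definition of sub-ψ additionally requires that each dominating non-negative supermartingale satisfies E[L_0^λ] ≤ 1; without it the claim fails, e.g. for S_t = c constant and large, V_t = 0, L_t^λ = exp(λc). *)

theory Defs
  imports "HOL-Probability.Probability"
begin

text \<open>
  The right end point of the domain may be infinite, hence its type \<^typ>\<open>ereal\<close>. A function
  on \<open>[0, lmax)\<close> is a total function on the reals of which only the values on
  \<open>cgf_dom lmax\<close> matter.
\<close>

definition cgf_dom :: "ereal \<Rightarrow> real set" where
  "cgf_dom lmax = {l. 0 \<le> l \<and> ereal l < lmax}"

text \<open>Derivative within the domain: one-sided at 0, two-sided at interior points.\<close>

definition dom_deriv :: "ereal \<Rightarrow> (real \<Rightarrow> real) \<Rightarrow> real \<Rightarrow> real" where
  "dom_deriv lmax f l = vector_derivative f (at l within cgf_dom lmax)"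

definition twice_continuously_differentiable :: "ereal \<Rightarrow> (real \<Rightarrow> real) \<Rightarrow> bool" where
  "twice_continuously_differentiable lmax f \<longleftrightarrow>
     f differentiable_on cgf_dom lmax \<and>
     dom_deriv lmax f differentiable_on cgf_dom lmax \<and>
     continuous_on (cgf_dom lmax) (dom_deriv lmax (dom_deriv lmax f))"

definition strictly_convex_on :: "real set \<Rightarrow> (real \<Rightarrow> real) \<Rightarrow> bool" where
  "strictly_convex_on A f \<longleftrightarrow> convex A \<and>
     (\<forall>x\<in>A. \<forall>y\<in>A. \<forall>t. x \<noteq> y \<longrightarrow> 0 < t \<longrightarrow> t < 1 \<longrightarrow>
        f ((1 - t) * x + t * y) < (1 - t) * f x + t * f y)"

definition CGF_like :: "ereal \<Rightarrow> (real \<Rightarrow> real) \<Rightarrow> bool" where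
  "CGF_like lmax \<psi> \<longleftrightarrow>
     0 < lmax \<and>
     (\<forall>l\<in>cgf_dom lmax. 0 \<le> \<psi> l) \<and>
     twice_continuously_differentiable lmax \<psi> \<and>
     strictly_convex_on (cgf_dom lmax) \<psi> \<and>
     \<psi> 0 = 0 \<and> dom_deriv lmax \<psi> 0 = 0 \<and>
     0 < dom_deriv lmax (dom_deriv lmax \<psi>) 0"

text \<open>
  The supremum is taken in the reals. It is finite for every \<open>u \<ge> 0\<close> as soon as
  the derivative of \<open>\<psi>\<close> tends to infinity at \<open>lmax\<close>, and the conjugate is then
  a bijection of \<open>[0, \<infinity>)\<close> onto itself, whose inverse is \<open>conjugate_inv\<close>.
\<close>

definition conjugate :: "ereal \<Rightarrow> (real \<Rightarrow> real) \<Rightarrow> real \<Rightarrow> real" where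
  "conjugate lmax \<psi> u = (SUP l\<in>cgf_dom lmax. u * l - \<psi> l)"

definition conjugate_inv :: "ereal \<Rightarrow> (real \<Rightarrow> real) \<Rightarrow> real \<Rightarrow> real" where
  "conjugate_inv lmax \<psi> = the_inv_into {0..} (conjugate lmax \<psi>)"

definition sub_filtration :: "'a measure \<Rightarrow> (nat \<Rightarrow> 'a measure) \<Rightarrow> bool" where
  "sub_filtration M F \<longleftrightarrow> filtration (space M) F \<and> (\<forall>t. subalgebra M (F t))"

definition adapted :: "(nat \<Rightarrow> 'a measure) \<Rightarrow> (nat \<Rightarrow> 'a \<Rightarrow> real) \<Rightarrow> bool" where
  "adapted F X \<longleftrightarrow> (\<forall>t. X t \<in> borel_measurable (F t))"

definition supermartingale ::
    "'a measure \<Rightarrow> (nat \<Rightarrow> 'a measure) \<Rightarrow> (nat \<Rightarrow> 'a \<Rightarrow> real) \<Rightarrow> bool" where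
  "supermartingale M F L \<longleftrightarrow>
     adapted F L \<and> (\<forall>t. integrable M (L t)) \<and>
     (\<forall>s t. s \<le> t \<longrightarrow> (AE \<omega> in M. real_cond_exp M (F s) (L t) \<omega> \<le> L s \<omega>))"

text \<open>
  The normalisation \<open>E[L\<^sub>0] \<le> 1\<close> is often left implicit in the definition of
  a sub-\<open>\<psi>\<close> process. It cannot be dropped: every constant process \<open>S\<close> with
  \<open>V = 0\<close> is dominated by the constant martingale \<open>exp (\<lambda> S)\<close>, so without it no
  crossing probability could be bounded.
\<close>

definition sub_psi ::
    "'a measure \<Rightarrow> (nat \<Rightarrow> 'a measure) \<Rightarrow> ereal \<Rightarrow> (real \<Rightarrow> real) \<Rightarrow>
     (nat \<Rightarrow> 'a \<Rightarrow> real) \<Rightarrow> (nat \<Rightarrow> 'a \<Rightarrow> real) \<Rightarrow> bool" where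
  "sub_psi M F lmax \<psi> S V \<longleftrightarrow>
     sub_filtration M F \<and> adapted F S \<and> adapted F V \<and>
     (\<forall>t. \<forall>\<omega>\<in>space M. 0 \<le> V t \<omega>) \<and>
     (\<forall>l\<in>cgf_dom lmax. \<exists>L. supermartingale M F L \<and>
        (\<forall>t. \<forall>\<omega>\<in>space M. 0 \<le> L t \<omega>) \<and>
        integral\<^sup>L M (L 0) \<le> 1 \<and>
        (AE \<omega> in M. \<forall>t. exp (l * S t \<omega> - \<psi> l * V t \<omega>) \<le> L t \<omega>))"

definition ell :: "real \<Rightarrow> real \<Rightarrow> (real \<Rightarrow> real) \<Rightarrow> real \<Rightarrow> real \<Rightarrow> real" where
  "ell \<alpha> \<delta> h \<rho> v = ln (h (log \<alpha> (max v \<rho> / \<rho>))) + ln (1 / \<delta>)"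

end

theory Submission
  imports Defs
begin

text \<open>
  Ville's inequality controls \<^emph>\<open>linear\<close> crossings: for a fixed \<open>\<lambda>\<close>, the event that
  \<open>\<lambda> S\<^sub>t - \<psi>(\<lambda>) V\<^sub>t \<ge> c\<close> for some \<open>t\<close> has probability at most \<open>exp (- c)\<close>, since
  the exponential is dominated by a non-negative supermartingale that starts at mean at most 1
  (\<open>ville_inequality\<close>). The boundary of the theorem is curved in \<open>V\<^sub>t\<close>, so it is
  stitched together from countably many such lines.

  Write \<open>w = max V\<^sub>t \<rho>\<close>, and call \<open>\<rho> \<alpha>\<^sup>k \<le> w \<le> \<rho> \<alpha>\<^sup>k\<^sup>+\<^sup>1\<close> the \<open>k\<close>-th epoch. Put
  \<open>c = ln (h k / \<delta>)\<close> and \<open>y = c / (\<rho> \<alpha>\<^sup>k)\<close>, and let \<open>\<lambda>\<close> attain the supremum that defines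
  the conjugate at the point \<open>u\<close> where the conjugate equals \<open>y\<close>, so that
  \<open>\<lambda> u - \<psi>(\<lambda>) = y\<close>. Within the epoch, the argument of the inverse conjugate in the boundary
  is at least \<open>y\<close>: the upper end of the epoch costs a factor \<open>\<alpha>\<close>, which is the factor in
  front of \<open>ell\<close>. Monotonicity of the inverse then gives, after a crossing,
  \<open>\<lambda> S\<^sub>t - \<psi>(\<lambda>) V\<^sub>t \<ge> w (\<lambda> u - \<psi>(\<lambda>)) = w y \<ge> c\<close>, where the last step is the lower end of
  the epoch (\<open>crossing_implies_linear_crossing\<close>). Thus a crossing in epoch \<open>k\<close> has probability
  at most \<open>\<delta> / h k\<close>, and the sum over \<open>k\<close> is at most \<open>\<delta>\<close>.

  It remains to see that the conjugate is invertible on the half-line and that its supremum is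
  attained; this is where the growth of the derivative of \<open>\<psi>\<close> enters
  (\<open>conjugate_attained_uniformly\<close>, \<open>conjugate_bij_betw\<close>).
\<close>

section \<open>Ville's maximal inequality\<close>

lemma supermartingale_set_integral_decreasing:
  assumes M: "prob_space M" and F: "sub_filtration M F" and L: "supermartingale M F L"
    and A: "A \<in> sets (F s)" and st: "s \<le> t"
  shows "(\<integral>\<omega>\<in>A. L t \<omega> \<partial>M) \<le> (\<integral>\<omega>\<in>A. L s \<omega> \<partial>M)"
proof -
  interpret prob_space M by fact
  have sub: "subalgebra M (F s)" using F by (auto simp: sub_filtration_def)
  interpret G: finite_measure_subalgebra M "F s"
    by unfold_locales (use sub in auto)
  have AM: "A \<in> sets M" using A sub by (auto simp: subalgebra_def)
  have int: "integrable M (L r)" for r using L by (auto simp: supermartingale_def)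
  have "(\<integral>\<omega>\<in>A. L t \<omega> \<partial>M) = (\<integral>\<omega>\<in>A. real_cond_exp M (F s) (L t) \<omega> \<partial>M)"
    by (rule G.real_cond_exp_intA[OF int A])
  also have "\<dots> \<le> (\<integral>\<omega>\<in>A. L s \<omega> \<partial>M)"
  proof (rule set_integral_mono_AE)
    show "set_integrable M A (real_cond_exp M (F s) (L t))"
      unfolding set_integrable_def
      by (intro integrable_mult_indicator AM G.real_cond_exp_int int)
    show "set_integrable M A (L s)"
      unfolding set_integrable_def by (intro integrable_mult_indicator AM int)
    have "AE \<omega> in M. real_cond_exp M (F s) (L t) \<omega> \<le> L s \<omega>"
      using L st by (auto simp: supermartingale_def)
    then show "AE \<omega>\<in>A in M. real_cond_exp M (F s) (L t) \<omega> \<le> L s \<omega>" by auto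
  qed
  finally show ?thesis .
qed

text \<open>
  An induction on the horizon replaces optional stopping. The integral over the paths that have
  stayed below \<open>c\<close> does not increase from \<open>L n\<close> to \<open>L (n + 1)\<close>, as that event is known at
  time \<open>n\<close>. Splitting off the paths that exceed \<open>c\<close> for the first time at \<open>n + 1\<close> then
  loses at least \<open>c\<close> times their probability, which the first summand gains.
\<close>

lemma ville_finite_horizon:
  assumes M: "prob_space M" and F: "sub_filtration M F" and L: "supermartingale M F L"
  shows "c * measure M {\<omega> \<in> space M. \<exists>t\<le>n. c \<le> L t \<omega>}
           + (\<integral>\<omega>\<in>{\<omega> \<in> space M. \<forall>t\<le>n. L t \<omega> < c}. L n \<omega> \<partial>M) \<le> integral\<^sup>L M (L 0)"
proof -
  interpret prob_space M by fact
  have sub: "subalgebra M (F t)" for t using F by (auto simp: sub_filtration_def)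
  have int: "integrable M (L r)" for r using L by (auto simp: supermartingale_def)
  have [measurable]: "L t \<in> borel_measurable M" for t
    using int by auto
  have Lmeas: "L s \<in> borel_measurable (F t)" if "s \<le> t" for s t
  proof -
    have "L s \<in> borel_measurable (F s)" using L by (auto simp: supermartingale_def adapted_def)
    moreover have "subalgebra (F t) (F s)"
      using F sub that unfolding sub_filtration_def subalgebra_def filtration_def by auto
    ultimately show ?thesis using measurable_from_subalg by blast
  qed
  define A where "A = (\<lambda>n. {\<omega> \<in> space M. \<forall>t\<le>n. L t \<omega> < c})"
  define C where "C = (\<lambda>n. {\<omega> \<in> space M. \<exists>t\<le>n. c \<le> L t \<omega>})"
  have [measurable]: "A n \<in> sets M" "C n \<in> sets M" for n
    unfolding A_def C_def by measurable
  have A_eq: "A n = space M - C n" for n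
    by (auto simp: A_def C_def not_le)
  have C0: "C 0 = {\<omega> \<in> space M. c \<le> L 0 \<omega>}" by (simp add: C_def)
  have C_Suc: "C (Suc n) = C n \<union> {\<omega> \<in> space M. c \<le> L (Suc n) \<omega>}" for n
    by (auto simp: C_def le_Suc_eq)
  have C_space: "C n \<subseteq> space M" for n by (auto simp: C_def)
  have AF: "A n \<in> sets (F n)" for n
  proof -
    have "A n = {\<omega> \<in> space (F n). \<forall>t\<in>{..n}. L t \<omega> < c}"
      using sub by (auto simp: A_def subalgebra_def)
    also have "\<dots> \<in> sets (F n)"
    proof (rule sets.sets_Collect_finite_All')
      fix t assume "t \<in> {..n}"
      then have [measurable]: "L t \<in> borel_measurable (F n)" by (simp add: Lmeas)
      show "{\<omega> \<in> space (F n). L t \<omega> < c} \<in> sets (F n)" by measurable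
    qed auto
    finally show ?thesis .
  qed
  have setint: "set_integrable M X (L r)" if "X \<in> sets M" for X r
    unfolding set_integrable_def using that int by (intro integrable_mult_indicator)
  have exceed: "c * measure M X \<le> (\<integral>\<omega>\<in>X. L r \<omega> \<partial>M)"
    if X: "X \<in> sets M" and ge: "\<And>\<omega>. \<omega> \<in> X \<Longrightarrow> c \<le> L r \<omega>" for X r
  proof -
    have "c * measure M X = (\<integral>\<omega>\<in>X. c \<partial>M)"
      using X by (simp add: set_lebesgue_integral_def)
    also have "\<dots> \<le> (\<integral>\<omega>\<in>X. L r \<omega> \<partial>M)"
      by (rule set_integral_mono)
        (use X ge setint in \<open>auto simp: set_integrable_def emeasure_eq_measure
            intro!: integrable_real_indicator\<close>)
    finally show ?thesis .
  qed
  have "c * measure M (C n) + (\<integral>\<omega>\<in>A n. L n \<omega> \<partial>M) \<le> integral\<^sup>L M (L 0)"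
  proof (induction n)
    case 0
    have "c * measure M (C 0) \<le> (\<integral>\<omega>\<in>C 0. L 0 \<omega> \<partial>M)"
      by (rule exceed) (use C0 in auto)
    then have "c * measure M (C 0) + (\<integral>\<omega>\<in>A 0. L 0 \<omega> \<partial>M)
        \<le> (\<integral>\<omega>\<in>C 0. L 0 \<omega> \<partial>M) + (\<integral>\<omega>\<in>A 0. L 0 \<omega> \<partial>M)"
      by (rule add_right_mono)
    also have "\<dots> = (\<integral>\<omega>\<in>C 0 \<union> A 0. L 0 \<omega> \<partial>M)"
      by (rule set_integral_Un[symmetric]) (simp_all add: setint A_eq)
    also have "C 0 \<union> A 0 = space M" unfolding A_eq C0 by blast
    also have "(\<integral>\<omega>\<in>space M. L 0 \<omega> \<partial>M) = integral\<^sup>L M (L 0)"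
      by (rule set_integral_space[OF int])
    finally show ?case .
  next
    case (Suc n)
    \<comment> \<open>the paths whose first exceedance is at time \<open>n + 1\<close>\<close>
    define D where "D = A n - A (Suc n)"
    have [measurable]: "D \<in> sets M" by (simp add: D_def)
    have D_ge: "c \<le> L (Suc n) \<omega>" if "\<omega> \<in> D" for \<omega>
      using that unfolding D_def A_eq C_Suc by blast
    have CD: "C (Suc n) = C n \<union> D" "C n \<inter> D = {}"
      unfolding D_def A_eq C_Suc using C_space by blast+
    have AD: "A n = D \<union> A (Suc n)" "D \<inter> A (Suc n) = {}"
      unfolding D_def A_eq C_Suc by blast+
    have D_le: "c * measure M D \<le> (\<integral>\<omega>\<in>D. L (Suc n) \<omega> \<partial>M)"
      by (rule exceed[OF _ D_ge]) simp_all
    have "c * measure M (C (Suc n)) + (\<integral>\<omega>\<in>A (Suc n). L (Suc n) \<omega> \<partial>M)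
        = c * measure M (C n) + (c * measure M D + (\<integral>\<omega>\<in>A (Suc n). L (Suc n) \<omega> \<partial>M))"
      using CD by (simp add: finite_measure_Union distrib_left)
    also have "\<dots> \<le> c * measure M (C n)
        + ((\<integral>\<omega>\<in>D. L (Suc n) \<omega> \<partial>M) + (\<integral>\<omega>\<in>A (Suc n). L (Suc n) \<omega> \<partial>M))"
      by (intro add_left_mono add_right_mono D_le)
    also have "(\<integral>\<omega>\<in>D. L (Suc n) \<omega> \<partial>M) + (\<integral>\<omega>\<in>A (Suc n). L (Suc n) \<omega> \<partial>M)
        = (\<integral>\<omega>\<in>A n. L (Suc n) \<omega> \<partial>M)"
      unfolding AD(1) by (rule set_integral_Un[OF AD(2), symmetric]) (simp_all add: setint)
    also have "\<dots> \<le> (\<integral>\<omega>\<in>A n. L n \<omega> \<partial>M)"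
      by (rule supermartingale_set_integral_decreasing[OF M F L AF]) simp
    finally show ?case using Suc.IH by simp
  qed
  then show ?thesis by (simp add: A_def C_def)
qed

theorem ville_inequality:
  assumes M: "prob_space M" and F: "sub_filtration M F" and L: "supermartingale M F L"
    and nonneg: "\<And>t \<omega>. \<omega> \<in> space M \<Longrightarrow> 0 \<le> L t \<omega>" and c: "0 < c"
  shows "measure M {\<omega> \<in> space M. \<exists>t. c \<le> L t \<omega>} \<le> integral\<^sup>L M (L 0) / c"
proof -
  interpret prob_space M by fact
  have [measurable]: "L t \<in> borel_measurable M" for t
    using L by (auto simp: supermartingale_def)
  define C where "C = (\<lambda>n. {\<omega> \<in> space M. \<exists>t\<le>n. c \<le> L t \<omega>})"
  have "(\<lambda>n. measure M (C n)) \<longlonglongrightarrow> measure M (\<Union>n. C n)"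
    by (rule finite_Lim_measure_incseq) (auto simp: C_def incseq_def intro: order_trans)
  moreover have "measure M (C n) \<le> integral\<^sup>L M (L 0) / c" for n
  proof -
    have "0 \<le> (\<integral>\<omega>\<in>{\<omega> \<in> space M. \<forall>t\<le>n. L t \<omega> < c}. L n \<omega> \<partial>M)"
      unfolding set_lebesgue_integral_def
      by (intro integral_nonneg_AE) (auto simp: indicator_def nonneg)
    then have "c * measure M (C n) \<le> integral\<^sup>L M (L 0)"
      using ville_finite_horizon[OF M F L, of c n] by (simp add: C_def)
    then show ?thesis using c by (simp add: field_simps)
  qed
  ultimately have "measure M (\<Union>n. C n) \<le> integral\<^sup>L M (L 0) / c"
    by (intro LIMSEQ_le_const2) auto
  also have "(\<Union>n. C n) = {\<omega> \<in> space M. \<exists>t. c \<le> L t \<omega>}" by (auto simp: C_def)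
  finally show ?thesis .
qed

section \<open>The convex conjugate as a bijection of the half-line\<close>

lemma zero_in_cgf_dom: "CGF_like lmax \<psi> \<Longrightarrow> 0 \<in> cgf_dom lmax"
  by (simp add: CGF_like_def cgf_dom_def zero_ereal_def)

lemma cgf_dom_interval: "l \<in> cgf_dom lmax \<Longrightarrow> 0 \<le> m \<Longrightarrow> m \<le> l \<Longrightarrow> m \<in> cgf_dom lmax"
  unfolding cgf_dom_def using order_le_less_trans[of "ereal m" "ereal l" lmax] by auto

lemma dom_deriv_has_derivative:
  assumes "CGF_like lmax \<psi>" and l: "l \<in> cgf_dom lmax"
  shows "(\<psi> has_real_derivative dom_deriv lmax \<psi> l) (at l within cgf_dom lmax)"
proof -
  have "\<psi> differentiable (at l within cgf_dom lmax)"
    using assms by (auto simp: CGF_like_def twice_continuously_differentiable_def differentiable_on_def)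
  then show ?thesis
    unfolding dom_deriv_def has_real_derivative_iff_has_vector_derivative
    by (simp add: vector_derivative_works)
qed

lemma dom_deriv_has_derivative_interior:
  assumes "CGF_like lmax \<psi>" and l: "l \<in> cgf_dom lmax" "0 < l"
  shows "(\<psi> has_real_derivative dom_deriv lmax \<psi> l) (at l)"
proof -
  have "open ({l. 0 < l} \<inter> {l. ereal l < lmax})"
    by (intro open_Int open_Collect_less continuous_on_ereal continuous_on_const continuous_on_id)
  moreover have "l \<in> {l. 0 < l} \<inter> {l. ereal l < lmax}"
    "{l. 0 < l} \<inter> {l. ereal l < lmax} \<subseteq> cgf_dom lmax"
    using l by (auto simp: cgf_dom_def)
  ultimately have "l \<in> interior (cgf_dom lmax)" by (meson interiorI)
  then have "at l within cgf_dom lmax = at l" by (rule at_within_interior)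
  with dom_deriv_has_derivative[OF assms(1,2)] show ?thesis by (simp only:)
qed

lemma CGF_like_continuous_on: "CGF_like lmax \<psi> \<Longrightarrow> continuous_on (cgf_dom lmax) \<psi>"
  by (auto simp: CGF_like_def twice_continuously_differentiable_def
      intro: differentiable_imp_continuous_on)

text \<open>
  Beyond \<open>b\<close> the function \<open>\<psi>\<close> grows at least as fast as a line of slope \<open>B\<close>, so the
  supremum in the conjugate at any \<open>u \<le> B\<close> is governed by the compact interval from 0 to \<open>b\<close>.
\<close>

lemma steep_eventually_slope:
  assumes cgf: "CGF_like lmax \<psi>"
    and steep: "filterlim (dom_deriv lmax \<psi> \<circ> real_of_ereal) at_top (at_left lmax)"
  obtains b where "b \<in> cgf_dom lmax"
    "\<And>m. m \<in> cgf_dom lmax \<Longrightarrow> b \<le> m \<Longrightarrow> B * (m - b) \<le> \<psi> m - \<psi> b"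
proof -
  have pos: "0 < lmax" using cgf by (simp add: CGF_like_def)
  have "\<forall>\<^sub>F x in at_left lmax. B \<le> (dom_deriv lmax \<psi> \<circ> real_of_ereal) x"
    using steep by (simp add: filterlim_at_top)
  then obtain e where e: "e < lmax" "\<And>x. e < x \<Longrightarrow> x < lmax \<Longrightarrow> B \<le> dom_deriv lmax \<psi> (real_of_ereal x)"
    using eventually_at_left[OF pos] by auto
  have "max 0 e < lmax" using pos e by simp
  then obtain b where b: "max 0 e < ereal b" "ereal b < lmax"
    using ereal_dense2 by blast
  have b0: "0 < b" and eb: "e < ereal b" using b by auto
  have bdom: "b \<in> cgf_dom lmax" using b b0 by (simp add: cgf_dom_def)
  have "B * (m - b) \<le> \<psi> m - \<psi> b" if m: "m \<in> cgf_dom lmax" "b \<le> m" for m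
  proof -
    have "\<psi> b - B * b \<le> \<psi> m - B * m"
    proof (rule DERIV_nonneg_imp_nondecreasing[OF m(2)])
      fix x assume x: "b \<le> x" "x \<le> m"
      then have xd: "x \<in> cgf_dom lmax" using cgf_dom_interval m b0 by auto
      have "B \<le> dom_deriv lmax \<psi> (real_of_ereal (ereal x))"
        using e(2)[of "ereal x"] eb x xd
        by (metis cgf_dom_def ereal_less_eq(3) mem_Collect_eq order_less_le_trans)
      moreover have "((\<lambda>x. \<psi> x - B * x) has_real_derivative dom_deriv lmax \<psi> x - B) (at x)"
        using dom_deriv_has_derivative_interior[OF cgf xd] x b0
        by (auto intro!: derivative_eq_intros)
      ultimately show "\<exists>y. ((\<lambda>x. \<psi> x - B * x) has_real_derivative y) (at x) \<and> 0 \<le> y"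
        by auto
    qed
    then show ?thesis by (simp add: algebra_simps)
  qed
  with bdom show ?thesis using that by blast
qed

text \<open>
  One bound \<open>b\<close> for the maximisers serves all \<open>u \<le> B\<close>. Since a maximiser is a subgradient
  of the conjugate, \<open>b\<close> becomes a Lipschitz constant in \<open>conjugate_continuous_on\<close>.
\<close>

lemma conjugate_attained_uniformly:
  assumes cgf: "CGF_like lmax \<psi>"
    and steep: "filterlim (dom_deriv lmax \<psi> \<circ> real_of_ereal) at_top (at_left lmax)"
  obtains b where "0 \<le> b"
    "\<And>u. u \<le> B \<Longrightarrow> \<exists>l\<in>cgf_dom lmax. l \<le> b \<and> conjugate lmax \<psi> u = u * l - \<psi> l \<and>
        (\<forall>m\<in>cgf_dom lmax. u * m - \<psi> m \<le> u * l - \<psi> l)"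
proof -
  obtain b where b: "b \<in> cgf_dom lmax"
    and slope: "\<And>m. m \<in> cgf_dom lmax \<Longrightarrow> b \<le> m \<Longrightarrow> B * (m - b) \<le> \<psi> m - \<psi> b"
    by (rule steep_eventually_slope[OF cgf steep, of B]) (rule that)
  have b0: "0 \<le> b" using b by (simp add: cgf_dom_def)
  have "\<exists>l\<in>cgf_dom lmax. l \<le> b \<and> conjugate lmax \<psi> u = u * l - \<psi> l \<and>
        (\<forall>m\<in>cgf_dom lmax. u * m - \<psi> m \<le> u * l - \<psi> l)" if u: "u \<le> B" for u
  proof -
    have sub: "{0..b} \<subseteq> cgf_dom lmax" using cgf_dom_interval[OF b] by auto
    have "continuous_on {0..b} (\<lambda>m. u * m - \<psi> m)"
      by (intro continuous_intros continuous_on_subset[OF CGF_like_continuous_on[OF cgf] sub])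
    then obtain l where l: "l \<in> {0..b}" "\<And>m. m \<in> {0..b} \<Longrightarrow> u * m - \<psi> m \<le> u * l - \<psi> l"
      using continuous_attains_sup[of "{0..b}" "\<lambda>m. u * m - \<psi> m"] b0 by fastforce
    have max: "u * m - \<psi> m \<le> u * l - \<psi> l" if m: "m \<in> cgf_dom lmax" for m
    proof (cases "m \<le> b")
      case True
      then show ?thesis using l m by (auto simp: cgf_dom_def)
    next
      case False
      then have "u * (m - b) \<le> B * (m - b)" using u by (intro mult_right_mono) auto
      also have "\<dots> \<le> \<psi> m - \<psi> b" using slope[OF m] False by simp
      finally have "u * m - \<psi> m \<le> u * b - \<psi> b" by (simp add: algebra_simps)
      also have "\<dots> \<le> u * l - \<psi> l" using l b0 by simp
      finally show ?thesis .
    qed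
    have "conjugate lmax \<psi> u = u * l - \<psi> l"
      unfolding conjugate_def by (rule cSup_eq_maximum) (use l sub max in auto)
    with max l sub show ?thesis by (intro bexI[of _ l]) auto
  qed
  with b0 show ?thesis by (rule that)
qed

lemma conjugate_attained:
  assumes "CGF_like lmax \<psi>"
    and "filterlim (dom_deriv lmax \<psi> \<circ> real_of_ereal) at_top (at_left lmax)"
  obtains l where "l \<in> cgf_dom lmax" "conjugate lmax \<psi> u = u * l - \<psi> l"
  using conjugate_attained_uniformly[OF assms, of u] by (metis order_refl)

lemma conjugate_upper:
  assumes "CGF_like lmax \<psi>"
    and "filterlim (dom_deriv lmax \<psi> \<circ> real_of_ereal) at_top (at_left lmax)"
    and "m \<in> cgf_dom lmax"
  shows "u * m - \<psi> m \<le> conjugate lmax \<psi> u"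
  using conjugate_attained_uniformly[OF assms(1,2), of u] assms(3) by (metis order_refl)

lemma conjugate_zero:
  assumes "CGF_like lmax \<psi>"
  shows "conjugate lmax \<psi> 0 = 0"
  unfolding conjugate_def
  by (rule cSup_eq_maximum)
    (use assms zero_in_cgf_dom[OF assms] in \<open>auto simp: CGF_like_def intro!: image_eqI[of _ _ 0]\<close>)

text \<open>Near 0 the line of slope \<open>u\<close> lies above \<open>\<psi>\<close>, whose derivative at 0 vanishes.\<close>

lemma conjugate_pos:
  assumes cgf: "CGF_like lmax \<psi>"
    and steep: "filterlim (dom_deriv lmax \<psi> \<circ> real_of_ereal) at_top (at_left lmax)"
    and u: "0 < u"
  shows "0 < conjugate lmax \<psi> u"
proof -
  have \<psi>0: "\<psi> 0 = 0" "dom_deriv lmax \<psi> 0 = 0" "0 < lmax"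
    using cgf by (auto simp: CGF_like_def)
  have "((\<lambda>l. \<psi> l - u * l) has_real_derivative - u) (at 0 within cgf_dom lmax)"
    using dom_deriv_has_derivative[OF cgf zero_in_cgf_dom[OF cgf]] \<psi>0
    by (auto intro!: derivative_eq_intros)
  from has_real_derivative_neg_dec_right[OF this] u
  obtain d where d: "0 < d"
    "\<And>l. 0 < l \<Longrightarrow> l \<in> cgf_dom lmax \<Longrightarrow> l < d \<Longrightarrow> \<psi> l - u * l < 0"
    using \<psi>0 by auto
  have "0 < min (ereal d) lmax" using d \<psi>0 by simp
  then obtain l where "0 < ereal l" "ereal l < min (ereal d) lmax"
    using ereal_dense2 by blast
  then have l: "0 < l" "l < d" "l \<in> cgf_dom lmax" by (auto simp: cgf_dom_def)
  then have "0 < u * l - \<psi> l" using d(2) by force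
  also have "\<dots> \<le> conjugate lmax \<psi> u" by (rule conjugate_upper[OF cgf steep l(3)])
  finally show ?thesis .
qed

text \<open>
  The maximiser at \<open>u > 0\<close> is not 0, because it has a positive value; keeping it while \<open>u\<close>
  grows increases the objective strictly.
\<close>

lemma conjugate_strict_mono_on:
  assumes cgf: "CGF_like lmax \<psi>"
    and steep: "filterlim (dom_deriv lmax \<psi> \<circ> real_of_ereal) at_top (at_left lmax)"
  shows "strict_mono_on {0..} (conjugate lmax \<psi>)"
proof (rule strict_mono_onI)
  fix u v :: real assume uv: "u \<in> {0..}" "v \<in> {0..}" "u < v"
  show "conjugate lmax \<psi> u < conjugate lmax \<psi> v"
  proof (cases "u = 0")
    case True
    then show ?thesis using conjugate_zero[OF cgf] conjugate_pos[OF cgf steep, of v] uv by simp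
  next
    case False
    obtain l where l: "l \<in> cgf_dom lmax" "conjugate lmax \<psi> u = u * l - \<psi> l"
      by (rule conjugate_attained[OF cgf steep, of u]) (rule that)
    have "0 < u * l - \<psi> l" using conjugate_pos[OF cgf steep, of u] uv False l by simp
    then have "l \<noteq> 0" using cgf by (auto simp: CGF_like_def)
    then have "0 < l" using l by (auto simp: cgf_dom_def)
    then have "u * l - \<psi> l < v * l - \<psi> l" using uv by simp
    also have "\<dots> \<le> conjugate lmax \<psi> v" by (rule conjugate_upper[OF cgf steep l(1)])
    finally show ?thesis using l by simp
  qed
qed

text \<open>
  Using the maximiser for \<open>v\<close> as a competitor at \<open>u\<close> bounds the difference of the two values
  by that maximiser times the distance. The resulting Lipschitz bound includes the end point 0,
  which a continuity argument from convexity alone would miss.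
\<close>

lemma conjugate_continuous_on:
  assumes cgf: "CGF_like lmax \<psi>"
    and steep: "filterlim (dom_deriv lmax \<psi> \<circ> real_of_ereal) at_top (at_left lmax)"
  shows "continuous_on {0..B} (conjugate lmax \<psi>)"
proof -
  obtain b where b: "0 \<le> b"
    and att: "\<And>u. u \<le> B \<Longrightarrow> \<exists>l\<in>cgf_dom lmax. l \<le> b \<and> conjugate lmax \<psi> u = u * l - \<psi> l \<and>
        (\<forall>m\<in>cgf_dom lmax. u * m - \<psi> m \<le> u * l - \<psi> l)"
    by (rule conjugate_attained_uniformly[OF cgf steep, of B]) (rule that)
  have step: "conjugate lmax \<psi> v - conjugate lmax \<psi> u \<le> b * \<bar>v - u\<bar>" if v: "v \<le> B" for u v
  proof -
    obtain l where l: "l \<in> cgf_dom lmax" "l \<le> b" "conjugate lmax \<psi> v = v * l - \<psi> l"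
      using att[OF v] by blast
    have "conjugate lmax \<psi> v - conjugate lmax \<psi> u \<le> (v * l - \<psi> l) - (u * l - \<psi> l)"
      using l conjugate_upper[OF cgf steep l(1), of u] by simp
    also have "\<dots> = l * (v - u)" by (simp add: algebra_simps)
    also have "\<dots> \<le> l * \<bar>v - u\<bar>" using l by (intro mult_left_mono) (auto simp: cgf_dom_def)
    also have "\<dots> \<le> b * \<bar>v - u\<bar>" using l by (intro mult_right_mono) auto
    finally show ?thesis .
  qed
  have "b-lipschitz_on {0..B} (conjugate lmax \<psi>)"
  proof (rule lipschitz_onI[OF _ b])
    fix u v assume "u \<in> {0..B}" "v \<in> {0..B}"
    then show "dist (conjugate lmax \<psi> u) (conjugate lmax \<psi> v) \<le> b * dist u v"
      using step[of u v] step[of v u] by (simp add: dist_real_def abs_le_iff abs_minus_commute)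
  qed
  then show ?thesis by (rule lipschitz_on_continuous_on)
qed

lemma conjugate_bij_betw:
  assumes cgf: "CGF_like lmax \<psi>"
    and steep: "filterlim (dom_deriv lmax \<psi> \<circ> real_of_ereal) at_top (at_left lmax)"
  shows "bij_betw (conjugate lmax \<psi>) {0..} {0..}"
proof (rule bij_betw_imageI)
  show "inj_on (conjugate lmax \<psi>) {0..}"
    by (rule strict_mono_on_imp_inj_on[OF conjugate_strict_mono_on[OF cgf steep]])
  show "conjugate lmax \<psi> ` {0..} = {0..}"
  proof (intro equalityI subsetI)
    fix y assume "y \<in> conjugate lmax \<psi> ` {0..}"
    then show "y \<in> {0..}"
      using conjugate_zero[OF cgf] conjugate_pos[OF cgf steep] by (force simp: le_less)
  next
    fix y :: real assume "y \<in> {0..}"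
    then have y: "0 \<le> y" by simp
    have "0 < lmax" using cgf by (simp add: CGF_like_def)
    then obtain l where "0 < ereal l" "ereal l < lmax" using ereal_dense2 by blast
    then have l: "0 < l" "l \<in> cgf_dom lmax" by (auto simp: cgf_dom_def)
    \<comment> \<open>the slope at which the competitor \<open>l\<close> has the value \<open>y\<close>, so that the conjugate at \<open>B\<close> is at least \<open>y\<close>\<close>
    define B where "B = (y + \<psi> l) / l"
    have "0 \<le> \<psi> l" using cgf l by (auto simp: CGF_like_def)
    then have B: "0 \<le> B" using y l by (simp add: B_def)
    have "y = B * l - \<psi> l" using l by (simp add: B_def)
    also have "\<dots> \<le> conjugate lmax \<psi> B" by (rule conjugate_upper[OF cgf steep l(2)])
    finally have "y \<le> conjugate lmax \<psi> B" .
    with y B obtain u where "0 \<le> u" "u \<le> B" "conjugate lmax \<psi> u = y"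
      using IVT'[of "conjugate lmax \<psi>" 0 y B] conjugate_zero[OF cgf]
        conjugate_continuous_on[OF cgf steep] by auto
    then show "y \<in> conjugate lmax \<psi> ` {0..}" by auto
  qed
qed

text \<open>
  The exponent \<open>l\<close> is chosen optimally for the level \<open>y\<close> alone, yet the lower bound \<open>y\<close>
  holds for all larger levels as well. So the exponent can depend on the epoch only and not on
  the path, as Ville's inequality demands.
\<close>

lemma conjugate_inv_tangent:
  assumes cgf: "CGF_like lmax \<psi>"
    and steep: "filterlim (dom_deriv lmax \<psi> \<circ> real_of_ereal) at_top (at_left lmax)"
    and y: "0 \<le> y"
  obtains l where "l \<in> cgf_dom lmax" "\<And>z. y \<le> z \<Longrightarrow> y \<le> l * conjugate_inv lmax \<psi> z - \<psi> l"
proof -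
  let ?f = "conjugate lmax \<psi>" and ?g = "conjugate_inv lmax \<psi>"
  note bij = conjugate_bij_betw[OF cgf steep]
  have inv: "0 \<le> ?g z" "?f (?g z) = z" if "0 \<le> z" for z
    using bij_betw_the_inv_into[OF bij] f_the_inv_into_f_bij_betw[OF bij, of z] that
    by (auto simp: conjugate_inv_def bij_betw_def)
  obtain l where l: "l \<in> cgf_dom lmax" "?f (?g y) = ?g y * l - \<psi> l"
    by (rule conjugate_attained[OF cgf steep, of "?g y"]) (rule that)
  have "y \<le> l * ?g z - \<psi> l" if z: "y \<le> z" for z
  proof -
    have "?g y \<le> ?g z"
    proof (rule ccontr)
      assume "\<not> ?g y \<le> ?g z"
      then have "?f (?g z) < ?f (?g y)"
        using inv y z by (intro strict_mono_onD[OF conjugate_strict_mono_on[OF cgf steep]]) auto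
      then show False using inv y z by simp
    qed
    then have "l * ?g y \<le> l * ?g z" using l by (intro mult_left_mono) (auto simp: cgf_dom_def)
    then show ?thesis using l(2) inv(2)[OF y] by (simp add: mult.commute)
  qed
  with l(1) show ?thesis using that by blast
qed

section \<open>Stitching over geometric epochs\<close>

lemma geometric_epoch:
  fixes \<alpha> \<rho> w :: real
  assumes "1 < \<alpha>" "0 < \<rho>" "\<rho> \<le> w"
  obtains k :: nat where "real k \<le> log \<alpha> (w / \<rho>)" "\<rho> * \<alpha> ^ k \<le> w" "w \<le> \<rho> * \<alpha> ^ Suc k"
proof -
  let ?x = "log \<alpha> (w / \<rho>)"
  define k where "k = nat \<lfloor>?x\<rfloor>"
  have pos: "0 < w / \<rho>" and x0: "0 \<le> ?x" using assms by auto
  have k: "real k \<le> ?x" "?x \<le> real (Suc k)" using x0 unfolding k_def by linarith+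
  have wx: "w = \<rho> * \<alpha> powr ?x" using assms pos by simp
  have "\<alpha> ^ k \<le> \<alpha> powr ?x" "\<alpha> powr ?x \<le> \<alpha> ^ Suc k"
    using assms k by (auto simp del: power_Suc of_nat_Suc powr_log_cancel simp flip: powr_realpow intro!: powr_mono)
  then have "\<rho> * \<alpha> ^ k \<le> w" "w \<le> \<rho> * \<alpha> ^ Suc k"
    using assms wx by (metis less_eq_real_def mult_left_mono)+
  with k(1) show ?thesis using that by blast
qed

text \<open>
  The upper end of the epoch gives \<open>y \<le> z\<close> for the argument \<open>z\<close> of \<open>g\<close> in the boundary,
  and the lower end turns the gain \<open>y\<close> per unit of \<open>max v \<rho>\<close> into \<open>ln (H / \<delta>)\<close>. Here
  \<open>g\<close> stands for the inverse conjugate, with the inequality of \<open>conjugate_inv_tangent\<close>, and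
  \<open>H\<close> for the value of \<open>h\<close> at the index of the epoch.
\<close>

lemma crossing_implies_linear_crossing:
  fixes g h \<psi> :: "real \<Rightarrow> real"
  assumes \<alpha>: "1 < \<alpha>" and \<rho>: "0 < \<rho>" and \<delta>: "0 < \<delta>"
    and hpos: "0 < H" and mono: "H \<le> h (log \<alpha> (max v \<rho> / \<rho>))"
    and lower: "\<rho> * \<alpha> ^ k \<le> max v \<rho>" and upper: "max v \<rho> \<le> \<rho> * \<alpha> ^ Suc k"
    and y: "y = ln (H / \<delta>) / (\<rho> * \<alpha> ^ k)" "0 \<le> y"
    and l: "0 \<le> l" "0 \<le> \<psi> l" and tangent: "\<And>z. y \<le> z \<Longrightarrow> y \<le> l * g z - \<psi> l"
    and cross: "max v \<rho> * g (\<alpha> / max v \<rho> * ell \<alpha> \<delta> h \<rho> v) \<le> s"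
  shows "H / \<delta> \<le> exp (l * s - \<psi> l * v)"
proof -
  define w where "w = max v \<rho>"
  define z where "z = \<alpha> / w * ell \<alpha> \<delta> h \<rho> v"
  have w: "0 < w" "v \<le> w" using \<rho> by (auto simp: w_def)
  have r: "0 < \<rho> * \<alpha> ^ k" using \<rho> \<alpha> by simp
  have c: "ln (H / \<delta>) = y * (\<rho> * \<alpha> ^ k)" unfolding y(1) using less_imp_neq[OF r] by (metis nonzero_eq_divide_eq)
  have ell_ge: "ln (H / \<delta>) \<le> ell \<alpha> \<delta> h \<rho> v"
    using mono hpos \<delta> by (simp add: ell_def ln_div)
  have "y * w \<le> y * (\<rho> * \<alpha> ^ Suc k)"
    using upper y(2) by (intro mult_left_mono) (auto simp: w_def)
  also have "\<dots> = \<alpha> * ln (H / \<delta>)" by (simp add: c mult_ac)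
  also have "\<dots> \<le> \<alpha> * ell \<alpha> \<delta> h \<rho> v" using ell_ge \<alpha> by (intro mult_left_mono) auto
  finally have "y \<le> z" using w by (simp add: z_def field_simps)
  then have tan: "y \<le> l * g z - \<psi> l" by (rule tangent)
  have "ln (H / \<delta>) \<le> w * y"
    using mult_left_mono[OF lower y(2)] by (simp add: c w_def mult_ac)
  also have "\<dots> \<le> w * (l * g z - \<psi> l)" using tan w by (intro mult_left_mono) auto
  also have "\<dots> = l * (w * g z) - \<psi> l * w" by (simp add: algebra_simps)
  also have "\<dots> \<le> l * s - \<psi> l * v"
    using cross l w by (intro diff_mono mult_left_mono) (auto simp: w_def z_def)
  finally have "exp (ln (H / \<delta>)) \<le> exp (l * s - \<psi> l * v)" by simp
  then show ?thesis using hpos \<delta> by simp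
qed

text \<open>
  The value \<open>f k = 0\<close> is excluded because its inverse is infinite in the extended non-negative
  reals.
\<close>

lemma ge_1_if_sum_inverse_le_1:
  fixes f :: "nat \<Rightarrow> real"
  assumes nonneg: "\<And>k. 0 \<le> f k" and sum: "(\<Sum>k. inverse (ennreal (f k))) \<le> 1"
  shows "1 \<le> f k"
proof -
  have "inverse (ennreal (f k)) = (\<Sum>i\<in>{k}. inverse (ennreal (f i)))" by simp
  also have "\<dots> \<le> (\<Sum>k. inverse (ennreal (f k)))"
    by (rule sum_le_suminf) auto
  also note sum
  finally have le: "inverse (ennreal (f k)) \<le> 1" .
  then have "0 < f k" using nonneg[of k] by (cases "f k = 0") (auto simp: top_unique)
  then have "ennreal (inverse (f k)) \<le> ennreal 1" using le by (simp add: inverse_ennreal)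
  then show ?thesis using \<open>0 < f k\<close> by (simp add: ennreal_le_iff inverse_le_1_iff)
qed

text \<open>
  The measure of a non-measurable \<open>E\<close> is 0 by convention, so an inclusion up to a null set into
  measurable sets suffices for every \<open>E\<close>.
\<close>

lemma union_bound_inverse_weights:
  fixes f :: "nat \<Rightarrow> real"
  assumes M: "prob_space M" and meas: "\<And>k. C k \<in> sets M"
    and bound: "\<And>k. measure M (C k) \<le> \<delta> / f k" and f: "\<And>k. 0 < f k"
    and sum: "(\<Sum>k. inverse (ennreal (f k))) \<le> 1" and \<delta>: "0 \<le> \<delta>"
    and null: "AE \<omega> in M. \<omega> \<in> E \<longrightarrow> \<omega> \<in> (\<Union>k. C k)"
  shows "measure M E \<le> \<delta>"
proof (cases "E \<in> sets M")
  case False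
  then show ?thesis using \<delta> by (simp add: measure_notin_sets)
next
  case True
  interpret prob_space M by fact
  have "emeasure M E \<le> emeasure M (\<Union>k. C k)"
    using null meas by (intro emeasure_mono_AE) auto
  also have "\<dots> \<le> (\<Sum>k. emeasure M (C k))"
    using meas by (intro emeasure_subadditive_countably) auto
  also have "\<dots> \<le> (\<Sum>k. ennreal \<delta> * inverse (ennreal (f k)))"
  proof (rule suminf_le)
    fix k
    have "emeasure M (C k) \<le> ennreal (\<delta> * inverse (f k))"
      using bound[of k] by (simp add: emeasure_eq_measure ennreal_leI divide_inverse)
    also have "\<dots> = ennreal \<delta> * inverse (ennreal (f k))"
      using f[of k] \<delta> by (simp add: ennreal_mult inverse_ennreal)
    finally show "emeasure M (C k) \<le> ennreal \<delta> * inverse (ennreal (f k))" .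
  qed auto
  also have "\<dots> \<le> ennreal \<delta> * 1"
    unfolding ennreal_suminf_cmult by (rule mult_left_mono[OF sum]) simp
  finally show ?thesis using \<delta> by (simp add: emeasure_eq_measure)
qed

theorem theorem3p1:
  fixes M :: "'a measure" and F :: "nat \<Rightarrow> 'a measure"
    and S V :: "nat \<Rightarrow> 'a \<Rightarrow> real"
    and lmax :: ereal and \<psi> h :: "real \<Rightarrow> real" and \<alpha> \<rho> \<delta> :: real
  assumes "prob_space M"
    and "CGF_like lmax \<psi>"
    and "filterlim (dom_deriv lmax \<psi> \<circ> real_of_ereal) at_top (at_left lmax)"
    and "sub_psi M F lmax \<psi> S V"
    and "\<alpha> > 1" and "\<rho> > 0" and "0 < \<delta>" and "\<delta> < 1"
    and "\<And>x. 0 \<le> x \<Longrightarrow> 0 \<le> h x"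
    and "mono_on {0..} h"
    and "(\<Sum>k. inverse (ennreal (h (real k)))) \<le> 1"
  shows "measure M {\<omega> \<in> space M. \<exists>t. S t \<omega> \<ge> max (V t \<omega>) \<rho> *
           conjugate_inv lmax \<psi> (\<alpha> / max (V t \<omega>) \<rho> * ell \<alpha> \<delta> h \<rho> (V t \<omega>))} \<le> \<delta>"
proof -
  note cgf = assms(2) and steep = assms(3) and \<alpha> = assms(5) and \<rho> = assms(6) and \<delta> = assms(7,8)
  have h1: "1 \<le> h (real k)" for k
    by (rule ge_1_if_sum_inverse_le_1[of "\<lambda>k. h (real k)", OF _ assms(11)]) (simp add: assms(9))
  have hpos: "0 < h (real k)" for k using h1[of k] by linarith
  \<comment> \<open>the target level for epoch \<open>k\<close>: the log-threshold per unit of \<open>\<rho> \<alpha>\<^sup>k\<close>\<close>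
  define y where "y = (\<lambda>k::nat. ln (h (real k) / \<delta>) / (\<rho> * \<alpha> ^ k))"
  have y0: "0 \<le> y k" for k
    using h1[of k] \<alpha> \<rho> \<delta> unfolding y_def by (intro divide_nonneg_pos ln_ge_zero) (auto simp: field_simps)
  have "\<exists>l\<in>cgf_dom lmax. \<forall>z\<ge>y k. y k \<le> l * conjugate_inv lmax \<psi> z - \<psi> l" for k
    using conjugate_inv_tangent[OF cgf steep y0[of k]] by metis
  then obtain l where l: "\<And>k. l k \<in> cgf_dom lmax"
    and tangent: "\<And>k z. y k \<le> z \<Longrightarrow> y k \<le> l k * conjugate_inv lmax \<psi> z - \<psi> (l k)"
    by metis
  have "\<forall>k. \<exists>L. supermartingale M F L \<and> (\<forall>t. \<forall>\<omega>\<in>space M. 0 \<le> L t \<omega>) \<and> integral\<^sup>L M (L 0) \<le> 1 \<and>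
        (AE \<omega> in M. \<forall>t. exp (l k * S t \<omega> - \<psi> (l k) * V t \<omega>) \<le> L t \<omega>)"
    using assms(4) l by (auto simp: sub_psi_def)
  from choice[OF this] obtain L where "\<forall>k. supermartingale M F (L k) \<and>
        (\<forall>t. \<forall>\<omega>\<in>space M. 0 \<le> L k t \<omega>) \<and> integral\<^sup>L M (L k 0) \<le> 1 \<and>
        (AE \<omega> in M. \<forall>t. exp (l k * S t \<omega> - \<psi> (l k) * V t \<omega>) \<le> L k t \<omega>)" ..
  then have L: "\<And>k. supermartingale M F (L k)"
    "\<And>k t \<omega>. \<omega> \<in> space M \<Longrightarrow> 0 \<le> L k t \<omega>" "\<And>k. integral\<^sup>L M (L k 0) \<le> 1"
    "\<And>k. AE \<omega> in M. \<forall>t. exp (l k * S t \<omega> - \<psi> (l k) * V t \<omega>) \<le> L k t \<omega>"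
    by blast+
  define C where "C = (\<lambda>k. {\<omega> \<in> space M. \<exists>t. h (real k) / \<delta> \<le> L k t \<omega>})"
  have [measurable]: "L k t \<in> borel_measurable M" for k t
    using L(1)[of k] by (auto simp: supermartingale_def)
  have F: "sub_filtration M F" using assms(4) by (simp add: sub_psi_def)
  have C_bound: "measure M (C k) \<le> \<delta> / h (real k)" for k
  proof -
    have "measure M (C k) \<le> integral\<^sup>L M (L k 0) / (h (real k) / \<delta>)"
      unfolding C_def using hpos[of k] \<delta> L(2)
      by (intro ville_inequality[OF assms(1) F L(1)]) auto
    also have "\<dots> \<le> 1 / (h (real k) / \<delta>)"
      using hpos[of k] \<delta> L(3)[of k] by (intro divide_right_mono) auto
    finally show ?thesis by simp
  qed
  show ?thesis
  proof (rule union_bound_inverse_weights[OF assms(1) _ C_bound hpos assms(11)])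
    show "C k \<in> sets M" for k unfolding C_def by measurable
    show "0 \<le> \<delta>" using \<delta> by simp
    have "AE \<omega> in M. \<forall>k t. exp (l k * S t \<omega> - \<psi> (l k) * V t \<omega>) \<le> L k t \<omega>"
      using L(4) by (simp add: AE_all_countable)
    then show "AE \<omega> in M. \<omega> \<in> {\<omega> \<in> space M. \<exists>t. S t \<omega> \<ge> max (V t \<omega>) \<rho> *
           conjugate_inv lmax \<psi> (\<alpha> / max (V t \<omega>) \<rho> * ell \<alpha> \<delta> h \<rho> (V t \<omega>))}
         \<longrightarrow> \<omega> \<in> (\<Union>k. C k)"
    proof (eventually_elim, intro impI)
      fix \<omega> assume dom: "\<forall>k t. exp (l k * S t \<omega> - \<psi> (l k) * V t \<omega>) \<le> L k t \<omega>"
        and "\<omega> \<in> {\<omega> \<in> space M. \<exists>t. S t \<omega> \<ge> max (V t \<omega>) \<rho> *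
           conjugate_inv lmax \<psi> (\<alpha> / max (V t \<omega>) \<rho> * ell \<alpha> \<delta> h \<rho> (V t \<omega>))}"
      then obtain t where \<omega>: "\<omega> \<in> space M" and cross: "max (V t \<omega>) \<rho> *
           conjugate_inv lmax \<psi> (\<alpha> / max (V t \<omega>) \<rho> * ell \<alpha> \<delta> h \<rho> (V t \<omega>)) \<le> S t \<omega>"
        by auto
      obtain k :: nat where k: "real k \<le> log \<alpha> (max (V t \<omega>) \<rho> / \<rho>)"
        "\<rho> * \<alpha> ^ k \<le> max (V t \<omega>) \<rho>" "max (V t \<omega>) \<rho> \<le> \<rho> * \<alpha> ^ Suc k"
        using geometric_epoch[OF \<alpha> \<rho>, of "max (V t \<omega>) \<rho>"] by auto
      have "h (real k) / \<delta> \<le> exp (l k * S t \<omega> - \<psi> (l k) * V t \<omega>)"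
      proof (rule crossing_implies_linear_crossing[where g = "conjugate_inv lmax \<psi>" and h = h
            and \<psi> = \<psi> and y = "y k" and l = "l k",
            OF \<alpha> \<rho> \<delta>(1) hpos _ k(2,3) _ y0 _ _ _ cross])
        show "h (real k) \<le> h (log \<alpha> (max (V t \<omega>) \<rho> / \<rho>))"
          using k(1) by (intro mono_onD[OF assms(10)]) auto
        show "y k = ln (h (real k) / \<delta>) / (\<rho> * \<alpha> ^ k)" by (simp only: y_def)
        show "0 \<le> l k" "0 \<le> \<psi> (l k)"
          using l[of k] cgf by (auto simp: cgf_dom_def CGF_like_def)
      qed (rule tangent)
      also have "\<dots> \<le> L k t \<omega>" using dom by blast
      finally show "\<omega> \<in> (\<Union>k. C k)" using \<omega> by (auto simp: C_def)
    qed
  qed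
qed

end
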